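(* Let $a\in\mathbb{R}$ and $k\in\mathbb{N}$. The $L^2(\mathbb{R})$-operator norm of the spectral projection $\Pi_{a,k}$ of the shifted harmonic oscillator $P_a$ associated to the eigenvalue $k$ is $$\|\Pi_{a,k}\| = \frac{e^{a^2}}{\pi k!}\iint_{\mathbb{R}^2}\left((x_1+a\sqrt2)^2+x_2^2\right)^k e^{-x_1^2-x_2^2}\,dx_1\,dx_2.$$
   Context: $\mathbb{N}=\{0,1,2,\dots\}$. The Hermite functions are $h_k(y) = (2^k k!\sqrt{\pi})^{-1/2}\left(y-\frac{d}{dy}\right)^k e^{-y^2/2}$, regarded as entire functions of $y$. For $a\in\mathbb{R}$ the shifted harmonic oscillator $P_a=\frac12(-\partial_y^2+(y-ia)^2-1)$ on $L^2(\mathbb{R})$ has compact resolvent and spectrum $\mathbb{N}$; its spectral projection at the eigenvalue $k\in\mathbb{N}$ is the rank-one operator $$\Pi_{a,k}f(y) = \langle f, h_k(\cdot+ia)\rangle_{L^2(\mathbb{R})}\, h_k(y-ia),\qquad \langle f,g\rangle=\int_{\mathbb{R}} f\bar g\,dy.$$ *)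

theory Defs
  imports "HOL-Analysis.Analysis"
begin

definition hermite_fun :: "nat \<Rightarrow> complex \<Rightarrow> complex" where
  "hermite_fun k z =
     of_real (1 / sqrt (2 ^ k * fact k * sqrt pi)) *
     (((\<lambda>g w. w * g w - deriv g w) ^^ k) (\<lambda>w. exp (- (w\<^sup>2) / 2))) z"

text \<open>
  Elements of $L^2(\mathbb{R})$ are represented by measurable functions that are not identified
  up to null sets. Inner product, norm and the operators below depend only on the class of a
  function modulo almost everywhere equality.
\<close>

definition L2 :: "(real \<Rightarrow> complex) set" where
  "L2 = {f. f \<in> borel_measurable lborel \<and> integrable lborel (\<lambda>y. (cmod (f y))\<^sup>2)}"

definition L2_inner :: "(real \<Rightarrow> complex) \<Rightarrow> (real \<Rightarrow> complex) \<Rightarrow> complex" where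
  "L2_inner f g = (LINT y|lborel. f y * cnj (g y))"

text \<open>
  The norm is infinite outside of $L^2(\mathbb{R})$. Hence the operator norm of \<open>T\<close>, taken over the
  closed unit ball, is finite only if \<open>T\<close> maps the ball into $L^2(\mathbb{R})$ and is bounded there.
\<close>

definition L2_norm :: "(real \<Rightarrow> complex) \<Rightarrow> ennreal" where
  "L2_norm f =
     (if f \<in> L2 then ennreal (sqrt (LINT y|lborel. (cmod (f y))\<^sup>2)) else \<infinity>)"

definition L2_opnorm :: "((real \<Rightarrow> complex) \<Rightarrow> (real \<Rightarrow> complex)) \<Rightarrow> ennreal" where
  "L2_opnorm T = (SUP f\<in>{f. L2_norm f \<le> 1}. L2_norm (T f))"

text \<open>
  The spectral projection, at the eigenvalue \<open>k\<close>, of the shifted harmonic oscillator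
  $P_a = \frac12(-\partial_y^2 + (y - ia)^2 - 1)$ on $L^2(\mathbb{R})$, given by its explicit
  rank-one form: $h_k(\cdot - ia)$ is the eigenfunction of $P_a$, and $h_k(\cdot + ia)$ that of the
  adjoint $P_{-a}$.
\<close>

definition spectral_proj :: "real \<Rightarrow> nat \<Rightarrow> (real \<Rightarrow> complex) \<Rightarrow> (real \<Rightarrow> complex)" where
  "spectral_proj a k f =
     (\<lambda>y. L2_inner f (\<lambda>t. hermite_fun k (of_real t + \<i> * of_real a)) *
          hermite_fun k (of_real y - \<i> * of_real a))"

end

theory Submission
  imports Defs "HOL-Probability.Distributions"
begin

text \<open>
  The projection has rank one, so its norm is $\|h_k(\cdot+ia)\|\,\|h_k(\cdot-ia)\|$, and the
  two factors agree because $h_k$ is real on the real axis. Writing $H_k$ for the Hermite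
  polynomials, $\|h_k(\cdot+ia)\|^2$ is a multiple of the diagonal entry of
  $I(k,l) = \int H_k(y+ia) H_l(y-ia) e^{-y^2}\,dy$, and with $b = a\sqrt2$ the double integral is the
  diagonal entry of $J(k,l) = \iint (z+b)^k (\bar z+b)^l e^{-|z|^2}$. Gaussian integration by parts
  gives $I(k+1,l) = 2ia\,I(k,l) + 2l\,I(k,l-1)$ and $J(k+1,l) = b\,J(k,l) + l\,J(k,l-1)$; after the
  rescaling $I(k,l) = \pi^{-1/2} (i\sqrt2)^k (-i\sqrt2)^l J(k,l)$ these are the same recurrence.
\<close>

section \<open>Gaussian moments and integration by parts on the real line\<close>

lemma integrable_power_gaussian:
  "integrable lborel (\<lambda>x::real. x ^ n * exp (- x\<^sup>2))"
  "integrable lborel (\<lambda>x::real. \<bar>x\<bar> ^ n * exp (- x\<^sup>2))"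
proof -
  \<comment> \<open>Up to the factor sqrt pi, e^(-x^2) is the normal density with mean 0 and
    variance 1/2, whose moments are known to be integrable.\<close>
  have *: "exp (- x\<^sup>2) = sqrt pi * normal_density 0 (1 / sqrt 2) x" for x :: real
    by (simp add: normal_density_def power_divide)
  show "integrable lborel (\<lambda>x::real. x ^ n * exp (- x\<^sup>2))"
    using integrable_mult_right[OF integrable_normal_moment[of "1 / sqrt 2" 0 n], of "sqrt pi"]
    by (simp add: * mult_ac)
  show "integrable lborel (\<lambda>x::real. \<bar>x\<bar> ^ n * exp (- x\<^sup>2))"
    using integrable_mult_right[OF integrable_normal_moment_abs[of "1 / sqrt 2" 0 n], of "sqrt pi"]
    by (simp add: * mult_ac)
qed

lemma integral_gaussian: "(LINT x|lborel. exp (- x\<^sup>2)) = sqrt pi"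
proof -
  have *: "exp (- x\<^sup>2) = sqrt pi * normal_density 0 (1 / sqrt 2) x" for x :: real
    by (simp add: normal_density_def power_divide)
  show ?thesis
    by (simp add: *)
qed

lemma integrable_poly_gaussian:
  fixes p :: "complex poly"
  shows "integrable lborel (\<lambda>x::real. poly p (of_real x) * of_real (exp (- x\<^sup>2)))"
proof -
  have "integrable lborel (\<lambda>x::real. \<Sum>i\<le>degree p. coeff p i * complex_of_real (x ^ i * exp (- x\<^sup>2)))"
    by (intro Bochner_Integration.integrable_sum integrable_mult_right integrable_of_real
        integrable_power_gaussian)
  then show ?thesis
    by (simp add: poly_altdef sum_distrib_right mult.assoc)
qed

text \<open>Supplies the vanishing boundary terms for integration by parts. Outside (-1, 1) one has
  |x| <= x^2, so e^(-x^2) is at most e^(-|x|), which beats every power.\<close>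

lemma tendsto_power_gaussian:
  "((\<lambda>x::real. x ^ n * exp (- x\<^sup>2)) \<longlongrightarrow> 0) at_infinity"
proof (rule Lim_null_comparison)
  show "\<forall>\<^sub>F x::real in at_infinity. norm (x ^ n * exp (- x\<^sup>2)) \<le> norm x ^ n / exp (norm x)"
    unfolding eventually_at_infinity
  proof (intro exI[of _ 1] allI impI)
    fix x :: real
    assume "1 \<le> norm x"
    then have "\<bar>x\<bar> \<le> x\<^sup>2"
      using mult_left_mono[of 1 "\<bar>x\<bar>" "\<bar>x\<bar>"] by (simp add: power2_eq_square)
    then have "exp (- x\<^sup>2) \<le> inverse (exp \<bar>x\<bar>)"
      by (simp flip: exp_minus)
    then show "norm (x ^ n * exp (- x\<^sup>2)) \<le> norm x ^ n / exp (norm x)"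
      by (simp add: abs_mult power_abs divide_inverse mult_left_mono)
  qed
  show "((\<lambda>x::real. norm x ^ n / exp (norm x)) \<longlongrightarrow> 0) at_infinity"
    by (rule filterlim_compose[OF tendsto_power_div_exp_0 filterlim_norm_at_top])
qed

lemma tendsto_poly_gaussian:
  fixes p :: "complex poly"
  shows "((\<lambda>x::real. poly p (of_real x) * of_real (exp (- x\<^sup>2))) \<longlongrightarrow> 0) at_infinity"
proof -
  have "((\<lambda>x::real. \<Sum>i\<le>degree p. coeff p i * complex_of_real (x ^ i * exp (- x\<^sup>2))) \<longlongrightarrow>
      (\<Sum>i\<le>degree p. coeff p i * of_real 0)) at_infinity"
    by (intro tendsto_sum tendsto_mult_left tendsto_of_real tendsto_power_gaussian)
  then show ?thesis
    by (simp add: poly_altdef sum_distrib_right mult.assoc)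
qed

text \<open>The derivative of p(x) e^(-x^2) is (p'(x) - 2 x p(x)) e^(-x^2); it integrates to 0
  because p(x) e^(-x^2) vanishes at both ends. Both recurrences below, on the line and in the plane,
  come from this identity.\<close>

lemma gaussian_integration_by_parts:
  fixes p :: "complex poly"
  shows "(LINT x|lborel. 2 * of_real x * poly p (of_real x) * of_real (exp (- x\<^sup>2))) =
    (LINT x|lborel. poly (pderiv p) (of_real x) * of_real (exp (- x\<^sup>2)))"
proof -
  let ?F = "\<lambda>x::real. poly p (of_real x) * of_real (exp (- x\<^sup>2))"
  let ?f = "\<lambda>x::real. poly (pderiv p - [:0, 2:] * p) (of_real x) * complex_of_real (exp (- x\<^sup>2))"
  have "(LBINT x=-\<infinity>..\<infinity>. ?f x) = 0 - 0"
  proof (rule interval_integral_FTC_integrable[where F = ?F])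
    fix x :: real
    have "((\<lambda>x. poly p (of_real x)) has_vector_derivative poly (pderiv p) (of_real x)) (at x)"
      using has_vector_derivative_real_field[OF poly_DERIV[of p "of_real x"]] .
    moreover have "((\<lambda>x. exp (- x\<^sup>2)) has_vector_derivative (- 2 * x * exp (- x\<^sup>2))) (at x)"
      unfolding has_real_derivative_iff_has_vector_derivative[symmetric]
      by (auto intro!: derivative_eq_intros)
    ultimately show "(?F has_vector_derivative ?f x) (at x)"
      by (auto intro!: derivative_eq_intros simp: algebra_simps)
    show "isCont ?f x"
      by (intro continuous_intros)
  next
    show "set_integrable lborel (einterval (-\<infinity>) \<infinity>) ?f"
      using integrable_poly_gaussian[of "pderiv p - [:0, 2:] * p"]
      by (simp add: set_integrable_def einterval_def)
    show "((?F \<circ> real_of_ereal) \<longlongrightarrow> 0) (at_right (-\<infinity>))"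
      "((?F \<circ> real_of_ereal) \<longlongrightarrow> 0) (at_left \<infinity>)"
      using tendsto_mono[OF at_bot_le_at_infinity tendsto_poly_gaussian[of p]]
        tendsto_mono[OF at_top_le_at_infinity tendsto_poly_gaussian[of p]]
      by (simp_all add: ereal_tendsto_simps)
  qed auto
  then have "(LINT x|lborel. ?f x) = 0"
    by (simp add: interval_lebesgue_integral_def set_lebesgue_integral_def einterval_def)
  moreover have "(LINT x|lborel. ?f x) =
      (LINT x|lborel. poly (pderiv p) (of_real x) * of_real (exp (- x\<^sup>2))) -
      (LINT x|lborel. poly ([:0, 2:] * p) (of_real x) * of_real (exp (- x\<^sup>2)))"
    using Bochner_Integration.integral_diff[OF integrable_poly_gaussian integrable_poly_gaussian,
        of "pderiv p" "[:0, 2:] * p"]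
    by (simp add: algebra_simps)
  ultimately show ?thesis
    by (simp add: mult_ac)
qed

section \<open>Hermite polynomials and the recurrence for their shifted Gaussian pairings\<close>

fun hermite_poly :: "nat \<Rightarrow> complex poly" where
  "hermite_poly 0 = 1"
| "hermite_poly (Suc k) = [:0, 2:] * hermite_poly k - pderiv (hermite_poly k)"

text \<open>Differentiating the recursion gives 2 H_k + (2x H_k' - H_k''). By induction H_k' = 2k
  H_(k-1), so the bracket is 2k times the recursion for H_k. At k = 0 the factor 0 makes the
  truncated \<open>k - 1\<close> harmless.\<close>

lemma pderiv_hermite_poly:
  "pderiv (hermite_poly k) = smult (of_nat (2 * k)) (hermite_poly (k - 1))"
proof (induction k)
  case (Suc k)
  have "pderiv (hermite_poly (Suc k)) =
      smult 2 (hermite_poly k) + ([:0, 2:] * pderiv (hermite_poly k) - pderiv (pderiv (hermite_poly k)))"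
    by (simp add: pderiv_mult pderiv_diff pderiv_pCons pderiv_smult)
  also have "[:0, 2:] * pderiv (hermite_poly k) - pderiv (pderiv (hermite_poly k)) =
      smult (of_nat (2 * k)) (hermite_poly k)"
    unfolding Suc.IH by (cases k) (simp_all add: pderiv_smult smult_diff_right)
  finally show ?case
    by (simp add: smult_add_left[symmetric])
qed simp

text \<open>The coefficients are real. This turns |H_k(y + ia)|^2 into H_k(y + ia) H_k(y - ia), a
  polynomial in the real variable y.\<close>

lemma cnj_hermite_poly: "cnj (poly (hermite_poly k) z) = poly (hermite_poly k) (cnj z)"
proof (rule poly_cnj_real)
  show "coeff (hermite_poly k) n \<in> \<real>" for n
    by (induction k arbitrary: n)
      (auto simp: coeff_pCons coeff_1 coeff_pderiv Reals_diff Reals_mult split: nat.split)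
qed

text \<open>The operator w - d/dw sends p(w) e^(-w^2/2) to (2 w p(w) - p'(w)) e^(-w^2/2), which is
  the recursion of \<open>hermite_poly\<close>.\<close>

lemma hermite_fun_eq:
  "hermite_fun k z = of_real (1 / sqrt (2 ^ k * fact k * sqrt pi)) *
    poly (hermite_poly k) z * exp (- (z\<^sup>2) / 2)"
proof -
  have "((\<lambda>g w. w * g w - deriv g w) ^^ k) (\<lambda>w. exp (- (w\<^sup>2) / 2)) =
      (\<lambda>w. poly (hermite_poly k) w * exp (- (w\<^sup>2) / 2))"
  proof (induction k)
    case (Suc k)
    have "deriv (\<lambda>w. poly (hermite_poly k) w * exp (- (w\<^sup>2) / 2)) w =
        (poly (pderiv (hermite_poly k)) w - w * poly (hermite_poly k) w) * exp (- (w\<^sup>2) / 2)" for w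
      by (rule DERIV_imp_deriv)
        (auto intro!: derivative_eq_intros simp: algebra_simps)
    then show ?case
      unfolding funpow.simps comp_apply Suc.IH
      by (intro ext) (simp add: algebra_simps)
  qed simp
  then show ?thesis
    by (simp add: hermite_fun_def)
qed

text \<open>The integral I(k,l) of the overview is the case c = ia, d = -ia. Independent shifts
  without conjugation make the pairing symmetric under exchanging (c,k) with (d,l), so one
  recurrence serves both indices.\<close>

definition hermite_pairing :: "complex \<Rightarrow> complex \<Rightarrow> nat \<Rightarrow> nat \<Rightarrow> complex" where
  "hermite_pairing c d k l = (LINT y|lborel. poly (hermite_poly k) (of_real y + c) *
     poly (hermite_poly l) (of_real y + d) * of_real (exp (- y\<^sup>2)))"

lemma hermite_pairing_commute: "hermite_pairing c d k l = hermite_pairing d c l k"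
  by (simp add: hermite_pairing_def mult_ac)

lemma integrable_hermite_pairing:
  "integrable lborel (\<lambda>y::real. poly (hermite_poly k) (of_real y + c) *
     poly (hermite_poly l) (of_real y + d) * of_real (exp (- y\<^sup>2)))"
  using integrable_poly_gaussian[of "pcompose (hermite_poly k) [:c, 1:] * pcompose (hermite_poly l) [:d, 1:]"]
  by (simp add: poly_pcompose add.commute)

text \<open>Write H_(k+1)(y + c) = 2c H_k(y + c) + 2y H_k(y + c) - H_k'(y + c). Integrating the 2y
  term by parts differentiates the product of both polynomials: the H_k' contributions cancel and
  H_l' = 2l H_(l-1) remains.\<close>

lemma hermite_pairing_Suc:
  "hermite_pairing c d (Suc k) l =
    2 * c * hermite_pairing c d k l + of_nat (2 * l) * hermite_pairing c d k (l - 1)"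
proof -
  let ?p = "pcompose (hermite_poly k) [:c, 1:]" and ?p' = "pcompose (pderiv (hermite_poly k)) [:c, 1:]"
  let ?q = "\<lambda>l. pcompose (hermite_poly l) [:d, 1:]"
  let ?E = "\<lambda>p. LINT y|lborel. poly p (complex_of_real y) * complex_of_real (exp (- y\<^sup>2))"
  have E_add: "?E (p + q) = ?E p + ?E q" for p q
    using Bochner_Integration.integral_add[OF integrable_poly_gaussian integrable_poly_gaussian, of p q]
    by (simp add: algebra_simps)
  have E_smult: "?E (smult s p) = s * ?E p" for s p
    by (simp add: mult.assoc)
  have pairing: "hermite_pairing c d k l = ?E (pcompose (hermite_poly k) [:c, 1:] * ?q l)" for k l
    by (simp add: hermite_pairing_def poly_pcompose add.commute)
  \<comment> \<open>The derivative and the 2y term stand on opposite sides, so only additivity of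
    \<open>?E\<close> is used; their integrals then cancel by integration by parts.\<close>
  have "pcompose (hermite_poly (Suc k)) [:c, 1:] * ?q l + pderiv (?p * ?q l) =
      smult (2 * c) (?p * ?q l) + smult (of_nat (2 * l)) (?p * ?q (l - 1)) + [:0, 2:] * (?p * ?q l)"
    (is "?lhs = ?rhs")
    unfolding poly_eq_poly_eq_iff[symmetric]
    by (simp add: fun_eq_iff poly_pcompose pderiv_mult pderiv_pcompose pderiv_hermite_poly pderiv_pCons
        pcompose_smult algebra_simps)
  then have "?E (pcompose (hermite_poly (Suc k)) [:c, 1:] * ?q l) + ?E (pderiv (?p * ?q l)) =
      2 * c * ?E (?p * ?q l) + of_nat (2 * l) * ?E (?p * ?q (l - 1)) + ?E ([:0, 2:] * (?p * ?q l))"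
    by (simp only: E_add[symmetric] E_smult[symmetric])
  moreover have "?E ([:0, 2:] * (?p * ?q l)) = ?E (pderiv (?p * ?q l))"
    using gaussian_integration_by_parts[of "?p * ?q l"] by (simp add: mult_ac)
  ultimately show ?thesis
    unfolding pairing by simp
qed

section \<open>Planar Gaussian moments and their recurrence\<close>

lemma integrable_lborel_times:
  fixes f g :: "real \<Rightarrow> real"
  assumes f: "integrable lborel f" and g: "integrable lborel g"
  shows "integrable (lborel :: (real \<times> real) measure) (\<lambda>(x, y). f x * g y)"
proof -
  have [measurable]: "f \<in> borel_measurable borel" "g \<in> borel_measurable borel"
    using f g by (simp_all add: borel_measurable_integrable)
  have "integrable (lborel \<Otimes>\<^sub>M lborel) (\<lambda>(x, y). f x * g y)"
  proof (rule lborel_pair.Fubini_integrable)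
    show "(\<lambda>(x, y). f x * g y) \<in> borel_measurable (lborel \<Otimes>\<^sub>M lborel)"
      by measurable
    show "integrable lborel (\<lambda>x. LINT y|lborel. norm (case (x, y) of (x, y) \<Rightarrow> f x * g y))"
      using f by (simp add: abs_mult)
  qed (use g in simp)
  then show ?thesis
    by (simp add: lborel_prod)
qed

lemma integrable_one_plus_abs_power_gaussian:
  "integrable lborel (\<lambda>x::real. (1 + \<bar>x\<bar>) ^ n * exp (- x\<^sup>2))"
proof -
  have "integrable lborel (\<lambda>x::real. \<Sum>i\<le>n. of_nat (n choose i) * (\<bar>x\<bar> ^ i * exp (- x\<^sup>2)))"
    by (intro Bochner_Integration.integrable_sum integrable_mult_right integrable_power_gaussian)
  then show ?thesis
    by (simp add: binomial_ring add.commute[of 1] sum_distrib_right mult.assoc)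
qed

text \<open>The integrand of J(k,l) in the overview, with z = x + iy. The two exponents are
  independent because the recurrence leaves the diagonal k = l.\<close>

definition plane_weight :: "complex \<Rightarrow> nat \<Rightarrow> nat \<Rightarrow> real \<Rightarrow> real \<Rightarrow> complex" where
  "plane_weight b k l x y = (of_real x + \<i> * of_real y + b) ^ k * (of_real x - \<i> * of_real y + b) ^ l *
     of_real (exp (- x\<^sup>2 - y\<^sup>2))"

text \<open>With Q = (1 + |x|)(1 + |y|), both |x| and |y| are at most Q, and both linear factors are
  at most (1 + |b|) Q. As Q is a product, the majorant splits into a function of x times a function
  of y.\<close>

lemma integrable_plane_weight:
  "integrable lborel (\<lambda>(x, y). of_real x ^ m * of_real y ^ n * plane_weight b k l x y)"
proof (rule Bochner_Integration.integrable_bound)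
  let ?N = "m + n + k + l"
  let ?f = "\<lambda>x::real. (1 + \<bar>x\<bar>) ^ ?N * exp (- x\<^sup>2)"
  show "integrable lborel (\<lambda>(x, y). (1 + cmod b) ^ (k + l) * ?f x * ?f y)"
    by (intro integrable_lborel_times integrable_mult_right integrable_one_plus_abs_power_gaussian)
  show "(\<lambda>(x, y). of_real x ^ m * of_real y ^ n * plane_weight b k l x y) \<in> borel_measurable lborel"
    unfolding plane_weight_def case_prod_unfold measurable_lborel2
    by (intro borel_measurable_continuous_onI continuous_intros)
  have "cmod (of_real x ^ m * of_real y ^ n * plane_weight b k l x y) \<le>
      (1 + cmod b) ^ (k + l) * ?f x * ?f y" for x y
  proof -
    define Q where "Q = (1 + \<bar>x\<bar>) * (1 + \<bar>y\<bar>)"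
    have Q: "\<bar>x\<bar> \<le> Q" "\<bar>y\<bar> \<le> Q" "\<bar>x\<bar> + \<bar>y\<bar> + r \<le> (1 + r) * Q" if "0 \<le> r" for r
    proof -
      have "0 \<le> \<bar>x\<bar> * \<bar>y\<bar>" "0 \<le> r * \<bar>x\<bar>" "0 \<le> r * \<bar>y\<bar>" "0 \<le> r * (\<bar>x\<bar> * \<bar>y\<bar>)"
        using that by simp_all
      then show "\<bar>x\<bar> \<le> Q" "\<bar>y\<bar> \<le> Q" "\<bar>x\<bar> + \<bar>y\<bar> + r \<le> (1 + r) * Q"
        unfolding Q_def by (simp_all add: algebra_simps)
    qed
    have A: "cmod (of_real x + \<i> * of_real y + b) \<le> (1 + cmod b) * Q"
      using norm_triangle_ineq[of "of_real x + \<i> * of_real y" b]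
        norm_triangle_ineq[of "of_real x" "\<i> * of_real y"] Q(3)[of "cmod b"]
      by (simp add: norm_mult)
    have B: "cmod (of_real x - \<i> * of_real y + b) \<le> (1 + cmod b) * Q"
      using norm_triangle_ineq[of "of_real x - \<i> * of_real y" b]
        norm_triangle_ineq4[of "of_real x" "\<i> * of_real y"] Q(3)[of "cmod b"]
      by (simp add: norm_mult)
    have "cmod (of_real x ^ m * of_real y ^ n * plane_weight b k l x y) =
        \<bar>x\<bar> ^ m * \<bar>y\<bar> ^ n * (cmod (of_real x + \<i> * of_real y + b) ^ k *
        cmod (of_real x - \<i> * of_real y + b) ^ l * exp (- x\<^sup>2 - y\<^sup>2))"
      by (simp add: plane_weight_def norm_mult norm_power)
    also have "\<dots> \<le> Q ^ m * Q ^ n * (((1 + cmod b) * Q) ^ k * ((1 + cmod b) * Q) ^ l * exp (- x\<^sup>2 - y\<^sup>2))"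
      by (intro mult_mono power_mono A B Q(1,2) order_refl mult_nonneg_nonneg zero_le_power)
        (auto simp: Q_def)
    also have "\<dots> = (1 + cmod b) ^ (k + l) * (Q ^ ?N * exp (- x\<^sup>2 - y\<^sup>2))"
      by (simp add: power_add power_mult_distrib)
    also have "\<dots> = (1 + cmod b) ^ (k + l) * ?f x * ?f y"
      by (simp add: Q_def power_mult_distrib exp_diff exp_minus divide_inverse)
    finally show ?thesis .
  qed
  then show "AE p in lborel. norm (case p of (x, y) \<Rightarrow> of_real x ^ m * of_real y ^ n * plane_weight b k l x y) \<le>
      norm (case p of (x, y) \<Rightarrow> (1 + cmod b) ^ (k + l) * ?f x * ?f y)"
    by (auto simp: abs_mult)
qed

definition plane_moment :: "complex \<Rightarrow> nat \<Rightarrow> nat \<Rightarrow> complex" where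
  "plane_moment b k l = (LINT (x, y)|lborel. plane_weight b k l x y)"

lemma integrable_plane_weight_low:
  "integrable lborel (\<lambda>(x, y). plane_weight b k l x y)"
  "integrable lborel (\<lambda>(x, y). of_real x * plane_weight b k l x y)"
  "integrable lborel (\<lambda>(x, y). of_real y * plane_weight b k l x y)"
  using integrable_plane_weight[of 0 0] integrable_plane_weight[of 1 0] integrable_plane_weight[of 0 1]
  by simp_all

lemma plane_moment_iterated:
  "plane_moment b k l = (LINT x|lborel. LINT y|lborel. plane_weight b k l x y)"
  using lborel_pair.integral_fst[of "plane_weight b k l"] integrable_plane_weight_low(1)[of b k l]
  by (simp add: plane_moment_def lborel_prod)

text \<open>For fixed y the weight is a constant times a polynomial in x times e^(-x^2), so the
  one-dimensional integration by parts applies under Fubini. A truncated \<open>k - 1\<close> or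
  \<open>l - 1\<close> at 0 comes with the factor 0.\<close>

lemma plane_weight_by_parts_fst:
  "(LINT (x, y)|lborel. 2 * of_real x * plane_weight b k l x y) =
    of_nat k * plane_moment b (k - 1) l + of_nat l * plane_moment b k (l - 1)"
proof -
  have int: "integrable lborel (\<lambda>(x, y). of_nat k * plane_weight b (k - 1) l x y +
      of_nat l * plane_weight b k (l - 1) x y)"
    using Bochner_Integration.integrable_add[OF
      integrable_mult_right[OF integrable_plane_weight_low(1)] integrable_mult_right[OF integrable_plane_weight_low(1)],
      of "of_nat k" b "k - 1" l "of_nat l" b k "l - 1"]
    by (simp add: case_prod_unfold)
  have int': "integrable lborel (\<lambda>(x, y). 2 * of_real x * plane_weight b k l x y)"
    using integrable_mult_right[OF integrable_plane_weight_low(2), of 2 b k l]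
    by (simp add: case_prod_unfold mult.assoc)
  have parts: "(LINT x|lborel. 2 * of_real x * plane_weight b k l x y) =
      (LINT x|lborel. of_nat k * plane_weight b (k - 1) l x y + of_nat l * plane_weight b k (l - 1) x y)" for y
  proof -
    let ?p = "[:b + \<i> * of_real y, 1:] ^ k * [:b - \<i> * of_real y, 1:] ^ l :: complex poly"
    have exp_split: "complex_of_real (exp (- x\<^sup>2 - y\<^sup>2)) =
        of_real (exp (- x\<^sup>2)) * of_real (exp (- y\<^sup>2))" for x
      by (simp add: exp_diff exp_minus divide_inverse)
    have "of_real (exp (- y\<^sup>2)) * (LINT x|lborel. 2 * of_real x * poly ?p (of_real x) * of_real (exp (- x\<^sup>2))) =
      of_real (exp (- y\<^sup>2)) * (LINT x|lborel. poly (pderiv ?p) (of_real x) * of_real (exp (- x\<^sup>2)))"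
      by (simp only: gaussian_integration_by_parts)
    then show ?thesis
      unfolding integral_mult_right_zero[symmetric]
      by (simp add: plane_weight_def exp_split pderiv_mult pderiv_power pderiv_pCons algebra_simps
          del: of_real_exp exp_of_real)
  qed
  have "(LINT (x, y)|lborel. 2 * of_real x * plane_weight b k l x y) =
      (LINT y|lborel. LINT x|lborel. 2 * of_real x * plane_weight b k l x y)"
    using lborel_pair.integral_snd[of "\<lambda>x y. 2 * of_real x * plane_weight b k l x y"] int'
    by (simp add: lborel_prod)
  also have "\<dots> = (LINT (x, y)|lborel. of_nat k * plane_weight b (k - 1) l x y + of_nat l * plane_weight b k (l - 1) x y)"
    unfolding parts
    using lborel_pair.integral_snd[of "\<lambda>x y. of_nat k * plane_weight b (k - 1) l x y + of_nat l * plane_weight b k (l - 1) x y"] int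
    by (simp add: lborel_prod)
  also have "\<dots> = of_nat k * plane_moment b (k - 1) l + of_nat l * plane_moment b k (l - 1)"
    using Bochner_Integration.integral_add[OF
      integrable_mult_right[OF integrable_plane_weight_low(1)] integrable_mult_right[OF integrable_plane_weight_low(1)],
      of "of_nat k" b "k - 1" l "of_nat l" b k "l - 1"]
    by (simp add: case_prod_unfold plane_moment_def)
  finally show ?thesis .
qed

text \<open>The same argument in y for fixed x; the slopes of z + b and of its companion factor are
  now i and -i.\<close>

lemma plane_weight_by_parts_snd:
  "(LINT (x, y)|lborel. 2 * of_real y * plane_weight b k l x y) =
    \<i> * of_nat k * plane_moment b (k - 1) l - \<i> * of_nat l * plane_moment b k (l - 1)"
proof -
  have int: "integrable lborel (\<lambda>(x, y). \<i> * of_nat k * plane_weight b (k - 1) l x y -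
      \<i> * of_nat l * plane_weight b k (l - 1) x y)"
    using Bochner_Integration.integrable_diff[OF
      integrable_mult_right[OF integrable_plane_weight_low(1)] integrable_mult_right[OF integrable_plane_weight_low(1)],
      of "\<i> * of_nat k" b "k - 1" l "\<i> * of_nat l" b k "l - 1"]
    by (simp add: case_prod_unfold)
  have int': "integrable lborel (\<lambda>(x, y). 2 * of_real y * plane_weight b k l x y)"
    using integrable_mult_right[OF integrable_plane_weight_low(3), of 2 b k l]
    by (simp add: case_prod_unfold mult.assoc)
  have parts: "(LINT y|lborel. 2 * of_real y * plane_weight b k l x y) =
      (LINT y|lborel. \<i> * of_nat k * plane_weight b (k - 1) l x y - \<i> * of_nat l * plane_weight b k (l - 1) x y)" for x
  proof -
    let ?p = "[:b + of_real x, \<i>:] ^ k * [:b + of_real x, - \<i>:] ^ l :: complex poly"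
    have exp_split: "complex_of_real (exp (- x\<^sup>2 - y\<^sup>2)) =
        of_real (exp (- x\<^sup>2)) * of_real (exp (- y\<^sup>2))" for y
      by (simp add: exp_diff exp_minus divide_inverse)
    have "of_real (exp (- x\<^sup>2)) * (LINT y|lborel. 2 * of_real y * poly ?p (of_real y) * of_real (exp (- y\<^sup>2))) =
      of_real (exp (- x\<^sup>2)) * (LINT y|lborel. poly (pderiv ?p) (of_real y) * of_real (exp (- y\<^sup>2)))"
      by (simp only: gaussian_integration_by_parts)
    then show ?thesis
      unfolding integral_mult_right_zero[symmetric]
      by (simp add: plane_weight_def exp_split pderiv_mult pderiv_power pderiv_pCons algebra_simps
          del: of_real_exp exp_of_real)
  qed
  have "(LINT (x, y)|lborel. 2 * of_real y * plane_weight b k l x y) =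
      (LINT x|lborel. LINT y|lborel. 2 * of_real y * plane_weight b k l x y)"
    using lborel_pair.integral_fst[of "\<lambda>x y. 2 * of_real y * plane_weight b k l x y"] int'
    by (simp add: lborel_prod)
  also have "\<dots> = (LINT (x, y)|lborel. \<i> * of_nat k * plane_weight b (k - 1) l x y - \<i> * of_nat l * plane_weight b k (l - 1) x y)"
    unfolding parts
    using lborel_pair.integral_fst[of "\<lambda>x y. \<i> * of_nat k * plane_weight b (k - 1) l x y - \<i> * of_nat l * plane_weight b k (l - 1) x y"] int
    by (simp add: lborel_prod)
  also have "\<dots> = \<i> * of_nat k * plane_moment b (k - 1) l - \<i> * of_nat l * plane_moment b k (l - 1)"
    using Bochner_Integration.integral_diff[OF
      integrable_mult_right[OF integrable_plane_weight_low(1)] integrable_mult_right[OF integrable_plane_weight_low(1)],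
      of "\<i> * of_nat k" b "k - 1" l "\<i> * of_nat l" b k "l - 1"]
    by (simp add: case_prod_unfold plane_moment_def)
  finally show ?thesis .
qed

text \<open>Split the new factor as x + iy + b. Integration by parts trades 2(x + iy) for d/dx + i
  d/dy, which annihilates the holomorphic factor (z + b)^k: the k-terms cancel and the l-terms
  double.\<close>

lemma plane_moment_Suc:
  "plane_moment b (Suc k) l = b * plane_moment b k l + of_nat l * plane_moment b k (l - 1)"
proof -
  let ?X = "LINT (x, y)|lborel. 2 * of_real x * plane_weight b k l x y"
  let ?Y = "LINT (x, y)|lborel. 2 * of_real y * plane_weight b k l x y"
  have "2 * plane_moment b (Suc k) l =
      (LINT p|lborel. (case p of (x, y) \<Rightarrow> 2 * (of_real x * plane_weight b k l x y)) +
        \<i> * (case p of (x, y) \<Rightarrow> 2 * (of_real y * plane_weight b k l x y)) +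
        2 * b * (case p of (x, y) \<Rightarrow> plane_weight b k l x y))"
    unfolding plane_moment_def integral_mult_right_zero[symmetric]
    by (intro Bochner_Integration.integral_cong) (auto simp: plane_weight_def algebra_simps)
  also have "\<dots> = ?X + \<i> * ?Y + 2 * b * plane_moment b k l"
    using integrable_plane_weight_low[of b k l]
    by (simp add: case_prod_unfold plane_moment_def mult.assoc)
  also have "?X + \<i> * ?Y = 2 * (of_nat l * plane_moment b k (l - 1))"
    unfolding plane_weight_by_parts_fst plane_weight_by_parts_snd
    by (simp add: algebra_simps)
  finally have "2 * plane_moment b (Suc k) l = 2 * (b * plane_moment b k l + of_nat l * plane_moment b k (l - 1))"
    by (simp add: algebra_simps)
  then show ?thesis
    by (subst (asm) mult_cancel_left) simp
qed

text \<open>The reflection y -> -y exchanges z with its conjugate. This carries the recurrence over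
  to the second index.\<close>

lemma plane_moment_swap: "plane_moment b k l = plane_moment b l k"
proof -
  have "(LINT y|lborel. plane_weight b k l x y) = (LINT y|lborel. plane_weight b l k x y)" for x
    using lborel_integral_real_affine[of "-1" "plane_weight b k l x" 0]
    by (simp add: plane_weight_def mult_ac)
  then show ?thesis
    unfolding plane_moment_iterated by simp
qed

lemma plane_moment_0_0: "plane_moment b 0 0 = of_real pi"
proof -
  have weight: "plane_weight b 0 0 = (\<lambda>x y. complex_of_real (exp (- x\<^sup>2) * exp (- y\<^sup>2)))"
    by (simp add: fun_eq_iff plane_weight_def exp_diff exp_minus divide_inverse)
  have "plane_moment b 0 0 = of_real (sqrt pi * sqrt pi)"
    unfolding plane_moment_iterated weight
    by (simp only: integral_complex_of_real integral_mult_right_zero integral_mult_left_zero integral_gaussian)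
  then show ?thesis
    by simp
qed

section \<open>Comparison of the two recurrences and the norm of a shifted Hermite function\<close>

lemma hermite_pairing_eq_plane_moment:
  fixes a :: real
  defines "c \<equiv> \<i> * of_real a"
  shows "hermite_pairing c (- c) k l =
    of_real (1 / sqrt pi) * (\<i> * of_real (sqrt 2)) ^ k * (- \<i> * of_real (sqrt 2)) ^ l *
      plane_moment (of_real (a * sqrt 2)) k l"
proof -
  define b where "b = complex_of_real (a * sqrt 2)"
  define r where "r = \<i> * complex_of_real (sqrt 2)"
  \<comment> \<open>These two relations make the recurrences agree: 2c = r b matches the leading
    terms (with -r for the shift -c), and (-r) r = 2 matches the terms with lowered index.\<close>
  have rb: "2 * c = r * b" and rr: "- r * r = 2"
    by (simp_all add: c_def r_def b_def complex_eq_iff)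
  have "hermite_pairing c (- c) k l =
      of_real (1 / sqrt pi) * r ^ k * (- r) ^ l * plane_moment b k l"
  proof (induction k arbitrary: l)
    case 0
    show ?case
    proof (induction l)
      \<comment> \<open>Both recurrences raise the first index only, so the row k = 0 is climbed by
        symmetry; the lowered terms carry the factor k = 0.\<close>
      case 0
      have "hermite_pairing c (- c) 0 0 = of_real (sqrt pi)"
        by (simp add: hermite_pairing_def integral_gaussian del: of_real_exp exp_of_real)
      also have "sqrt pi = 1 / sqrt pi * pi"
        by (simp add: real_div_sqrt)
      finally show ?case
        by (simp only: plane_moment_0_0 of_real_mult power_0 mult_1_right)
    next
      case (Suc l)
      have "hermite_pairing c (- c) 0 (Suc l) = - r * b * hermite_pairing c (- c) 0 l"
        unfolding hermite_pairing_commute[of c] hermite_pairing_Suc using rb by simp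
      moreover have "plane_moment b 0 (Suc l) = b * plane_moment b 0 l"
        unfolding plane_moment_swap[of b 0] plane_moment_Suc by simp
      ultimately show ?case
        by (simp add: Suc)
    qed
  next
    case (Suc k)
    show ?case
    proof (cases l)
      case 0
      then show ?thesis
        by (simp add: hermite_pairing_Suc plane_moment_Suc Suc rb)
    next
      case (Suc m)
      \<comment> \<open>Here l = m + 1, and the prefactor at (k, m) lacks one r and one -r compared
        with (k + 1, l). Writing 2 as -r * r supplies both.\<close>
      have "hermite_pairing c (- c) (Suc k) l =
          r * b * hermite_pairing c (- c) k l + (- r * r) * of_nat l * hermite_pairing c (- c) k m"
        unfolding hermite_pairing_Suc rb rr by (simp add: Suc)
      then show ?thesis
        unfolding Suc.IH plane_moment_Suc by (simp add: Suc algebra_simps add_divide_distrib diff_divide_distrib)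
    qed
  qed
  then show ?thesis
    by (simp add: b_def r_def)
qed

text \<open>For real b the two linear factors are conjugate, so their product is |z + b|^2 and the
  moment is the integral of the theorem.\<close>

lemma plane_moment_diagonal:
  "plane_moment (of_real b) k k =
    of_real (LINT (x, y)|lborel. ((x + b)\<^sup>2 + y\<^sup>2) ^ k * exp (- (x\<^sup>2) - y\<^sup>2))"
proof -
  have "plane_weight (of_real b) k k x y = of_real (((x + b)\<^sup>2 + y\<^sup>2) ^ k * exp (- (x\<^sup>2) - y\<^sup>2))" for x y
  proof -
    have "(of_real x + \<i> * of_real y + of_real b) * (of_real x - \<i> * of_real y + of_real b) =
        complex_of_real ((x + b)\<^sup>2 + y\<^sup>2)"
      by (simp add: complex_eq_iff power2_eq_square algebra_simps)
    then show ?thesis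
      unfolding plane_weight_def power_mult_distrib[symmetric] by simp
  qed
  then show ?thesis
    by (simp add: plane_moment_def case_prod_unfold del: of_real_mult of_real_power of_real_add)
qed

text \<open>The real part of -(y + ia)^2 is a^2 - y^2, which is where e^(a^2) comes from. The
  polynomial factor becomes the integrand of \<open>hermite_pairing\<close>.\<close>

lemma cmod_hermite_fun_power2:
  "complex_of_real ((cmod (hermite_fun k (of_real y + \<i> * of_real a)))\<^sup>2) =
    of_real (exp (a\<^sup>2) / (2 ^ k * fact k * sqrt pi)) *
    (poly (hermite_poly k) (of_real y + \<i> * of_real a) *
     poly (hermite_poly k) (of_real y + - (\<i> * of_real a)) * of_real (exp (- y\<^sup>2)))"
proof -
  let ?z = "of_real y + \<i> * complex_of_real a" and ?n = "2 ^ k * fact k * sqrt pi"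
  have "(cmod (exp (- ?z\<^sup>2 / 2)))\<^sup>2 = exp (a\<^sup>2) * exp (- y\<^sup>2)"
    by (simp add: norm_exp_eq_Re power2_eq_square flip: exp_add)
  moreover have "complex_of_real ((cmod (poly (hermite_poly k) ?z))\<^sup>2) =
      poly (hermite_poly k) ?z * poly (hermite_poly k) (of_real y + - (\<i> * of_real a))"
    unfolding complex_norm_square cnj_hermite_poly by simp
  moreover have "(cmod (hermite_fun k ?z))\<^sup>2 =
      1 / ?n * (cmod (poly (hermite_poly k) ?z))\<^sup>2 * (cmod (exp (- ?z\<^sup>2 / 2)))\<^sup>2"
    by (simp add: hermite_fun_eq norm_mult norm_divide power_mult_distrib power_divide)
  ultimately show ?thesis
    by simp
qed

lemma continuous_on_hermite_fun: "continuous_on A (hermite_fun k)"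
  unfolding hermite_fun_eq[abs_def] by (intro continuous_intros) auto

lemma hermite_fun_shift_L2: "(\<lambda>y. hermite_fun k (of_real y + \<i> * of_real a)) \<in> L2"
proof -
  have "complex_integrable lborel (\<lambda>y. of_real ((cmod (hermite_fun k (of_real y + \<i> * of_real a)))\<^sup>2))"
    unfolding cmod_hermite_fun_power2
    by (intro integrable_mult_right integrable_hermite_pairing)
  moreover have "(\<lambda>y. hermite_fun k (of_real y + \<i> * of_real a)) \<in> borel_measurable borel"
    by (intro borel_measurable_continuous_onI continuous_on_compose2[OF continuous_on_hermite_fun]
        continuous_intros) auto
  ultimately show ?thesis
    by (simp add: L2_def complex_of_real_integrable_eq del: of_real_power)
qed

lemma integral_cmod_hermite_fun_shift:
  "(LINT y|lborel. (cmod (hermite_fun k (of_real y + \<i> * of_real a)))\<^sup>2) =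
    exp (a\<^sup>2) / (pi * fact k) *
      (LINT (x1, x2)|lborel. ((x1 + a * sqrt 2)\<^sup>2 + x2\<^sup>2) ^ k * exp (- (x1\<^sup>2) - x2\<^sup>2))"
  (is "?l = ?c * ?J")
proof -
  have "complex_of_real ?l = of_real (exp (a\<^sup>2) / (2 ^ k * fact k * sqrt pi)) *
      hermite_pairing (\<i> * of_real a) (- (\<i> * of_real a)) k k"
    unfolding integral_complex_of_real[symmetric] cmod_hermite_fun_power2 hermite_pairing_def
    by simp
  also have "\<dots> = of_real (exp (a\<^sup>2) / (2 ^ k * fact k * sqrt pi)) *
      (of_real (1 / sqrt pi) * of_real (2 ^ k) * of_real ?J)"
  proof -
    \<comment> \<open>On the diagonal the rescaling factor is 2^k, cancelling the 2^k in the
      normalisation of h_k.\<close>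
    have "(\<i> * complex_of_real (sqrt 2)) * (- \<i> * of_real (sqrt 2)) = of_real 2"
      by (simp add: complex_eq_iff)
    then have "(\<i> * complex_of_real (sqrt 2)) ^ k * (- \<i> * of_real (sqrt 2)) ^ k = of_real (2 ^ k)"
      unfolding power_mult_distrib[symmetric] by simp
    then show ?thesis
      unfolding hermite_pairing_eq_plane_moment plane_moment_diagonal by (simp only: mult.assoc)
  qed
  also have "\<dots> = of_real (exp (a\<^sup>2) / (2 ^ k * fact k * sqrt pi) * (1 / sqrt pi * 2 ^ k * ?J))"
    by (simp only: of_real_mult)
  finally have "?l = exp (a\<^sup>2) / (2 ^ k * fact k * sqrt pi) * (1 / sqrt pi * 2 ^ k * ?J)"
    by (simp only: of_real_eq_iff)
  also have "\<dots> = ?c * ?J"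
    by (simp add: field_simps)
  finally show ?thesis .
qed

section \<open>The operator norm of a rank-one operator\<close>

lemma L2_norm_mult_left:
  assumes "v \<in> L2"
  shows "L2_norm (\<lambda>y. c * v y) = ennreal (cmod c) * L2_norm v"
proof -
  have "(\<lambda>y. c * v y) \<in> L2"
    using assms by (auto simp: L2_def norm_mult power_mult_distrib)
  then show ?thesis
    using assms by (simp add: L2_norm_def norm_mult power_mult_distrib real_sqrt_mult ennreal_mult)
qed

lemma L2_norm_power2:
  assumes "f \<in> L2"
  shows "(L2_norm f)\<^sup>2 = (\<integral>\<^sup>+y. (ennreal (cmod (f y)))\<^sup>2 \<partial>lborel)"
proof -
  have "(\<integral>\<^sup>+y. (ennreal (cmod (f y)))\<^sup>2 \<partial>lborel) = (\<integral>\<^sup>+y. ennreal ((cmod (f y))\<^sup>2) \<partial>lborel)"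
    by (simp add: ennreal_power)
  also have "\<dots> = ennreal (LINT y|lborel. (cmod (f y))\<^sup>2)"
    using assms by (intro nn_integral_eq_integral) (auto simp: L2_def)
  finally show ?thesis
    using assms by (simp add: L2_norm_def ennreal_power)
qed

lemma ennreal_power2_le_imp_le:
  fixes x y :: ennreal
  assumes "x\<^sup>2 \<le> y\<^sup>2"
  shows "x \<le> y"
  using assms
  by (cases x rule: ennreal_cases; cases y rule: ennreal_cases)
    (auto simp: ennreal_power top_power_ennreal top_unique intro: power2_le_imp_le)

lemma L2_Cauchy_Schwarz:
  assumes f: "f \<in> L2" and g: "g \<in> L2"
  shows "ennreal (cmod (L2_inner f g)) \<le> L2_norm f * L2_norm g"
proof -
  have [measurable]: "f \<in> borel_measurable borel" "g \<in> borel_measurable borel"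
    using f g by (simp_all add: L2_def)
  let ?N = "\<integral>\<^sup>+y. ennreal (cmod (f y)) * ennreal (cmod (g y)) \<partial>lborel"
  have "?N\<^sup>2 \<le> (L2_norm f * L2_norm g)\<^sup>2"
    unfolding power_mult_distrib L2_norm_power2[OF f] L2_norm_power2[OF g]
    by (rule Cauchy_Schwarz_nn_integral) measurable
  then have N: "?N \<le> L2_norm f * L2_norm g"
    by (rule ennreal_power2_le_imp_le)
  have "ennreal (cmod (L2_inner f g)) \<le> (\<integral>\<^sup>+y. norm (f y * cnj (g y)) \<partial>lborel)"
  proof (cases "integrable lborel (\<lambda>y. f y * cnj (g y))")
    case True
    then show ?thesis
      unfolding L2_inner_def by (rule integral_norm_bound_ennreal)
  \<comment> \<open>The Bochner integral of a non-integrable function is 0 by convention, so the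
    bound is trivial in this case.\<close>
  qed (simp add: L2_inner_def not_integrable_integral_eq)
  also have "\<dots> = ?N"
    by (simp add: norm_mult ennreal_mult)
  finally show ?thesis
    using N by order
qed

text \<open>Cauchy-Schwarz gives the upper bound, and the normalised multiple of u attains
  it.\<close>

lemma L2_opnorm_rank_one:
  assumes u: "u \<in> L2" and v: "v \<in> L2"
  shows "L2_opnorm (\<lambda>f y. L2_inner f u * v y) = L2_norm u * L2_norm v"
proof -
  have norm: "L2_norm (\<lambda>y. L2_inner f u * v y) = ennreal (cmod (L2_inner f u)) * L2_norm v" for f
    by (rule L2_norm_mult_left[OF v])
  have "L2_norm (\<lambda>y. L2_inner f u * v y) \<le> L2_norm u * L2_norm v" if "L2_norm f \<le> 1" for f
  proof -
    have "f \<in> L2"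
      using that by (auto simp: L2_norm_def top_unique split: if_splits)
    then have "ennreal (cmod (L2_inner f u)) \<le> L2_norm f * L2_norm u"
      by (rule L2_Cauchy_Schwarz[OF _ u])
    also have "\<dots> \<le> 1 * L2_norm u"
      by (intro mult_right_mono that) simp
    finally show ?thesis
      unfolding norm by (simp add: mult_right_mono)
  qed
  moreover have "\<exists>f. L2_norm f \<le> 1 \<and> L2_norm u * L2_norm v \<le> L2_norm (\<lambda>y. L2_inner f u * v y)"
  proof -
    define I where "I = (LINT y|lborel. (cmod (u y))\<^sup>2)"
    have I: "0 \<le> I"
      by (simp add: I_def)
    have norm_u: "L2_norm u = ennreal (sqrt I)"
      using u by (simp add: L2_norm_def I_def)
    \<comment> \<open>The extremal function for Cauchy-Schwarz. If I = 0, division by zero makes it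
      the zero function, and both the norm bound and the value sqrt I of the inner product still
      hold.\<close>
    let ?f = "\<lambda>y. of_real (1 / sqrt I) * u y"
    have "L2_norm ?f = ennreal (1 / sqrt I * sqrt I)"
      unfolding L2_norm_mult_left[OF u] norm_u
      using I by (simp add: norm_divide ennreal_mult[symmetric])
    also have "\<dots> \<le> 1"
      by simp
    finally have f: "L2_norm ?f \<le> 1" .
    have "L2_inner ?f u = (LINT y|lborel. of_real (1 / sqrt I * (cmod (u y))\<^sup>2))"
      unfolding L2_inner_def of_real_mult complex_norm_square by (simp only: mult.assoc)
    also have "\<dots> = of_real (sqrt I)"
      unfolding integral_complex_of_real integral_mult_right_zero I_def[symmetric]
      using I by (simp add: real_div_sqrt)
    finally have "ennreal (cmod (L2_inner ?f u)) = L2_norm u"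
      using I by (simp add: norm_u)
    then show ?thesis
      using f norm by (intro exI[of _ ?f]) simp
  qed
  ultimately show ?thesis
    unfolding L2_opnorm_def by (intro antisym SUP_least) (auto intro: SUP_upper2)
qed

theorem theorem4p1:
  fixes a :: real and k :: nat
  shows "L2_opnorm (spectral_proj a k) =
    ennreal (exp (a\<^sup>2) / (pi * fact k) *
      (LINT (x1, x2)|(lborel :: (real \<times> real) measure).
         ((x1 + a * sqrt 2)\<^sup>2 + x2\<^sup>2) ^ k * exp (- (x1\<^sup>2) - x2\<^sup>2)))"
proof -
  let ?u = "\<lambda>a y. hermite_fun k (of_real y + \<i> * of_real a)"
  let ?N = "LINT y|lborel. (cmod (?u a y))\<^sup>2"
  have v: "(\<lambda>y. hermite_fun k (of_real y - \<i> * of_real a)) = ?u (- a)"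
    by simp
  \<comment> \<open>Replacing a by -a exchanges the factors H_k(y + ia) and H_k(y - ia) and keeps
    a^2, so the two moduli agree pointwise.\<close>
  have "complex_of_real ((cmod (?u (- a) y))\<^sup>2) = of_real ((cmod (?u a y))\<^sup>2)" for y
    unfolding cmod_hermite_fun_power2 by (simp add: mult_ac)
  then have "(cmod (?u (- a) y))\<^sup>2 = (cmod (?u a y))\<^sup>2" for y
    by (simp only: of_real_eq_iff)
  then have norm: "L2_norm (?u a) = ennreal (sqrt ?N)" "L2_norm (?u (- a)) = ennreal (sqrt ?N)"
    unfolding L2_norm_def by (simp_all only: hermite_fun_shift_L2 if_True)
  have "spectral_proj a k = (\<lambda>f y. L2_inner f (?u a) * ?u (- a) y)"
    by (simp add: spectral_proj_def fun_eq_iff)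
  then have "L2_opnorm (spectral_proj a k) = L2_norm (?u a) * L2_norm (?u (- a))"
    by (simp only: L2_opnorm_rank_one[OF hermite_fun_shift_L2 hermite_fun_shift_L2])
  also have "\<dots> = ennreal ?N"
    unfolding norm by (simp flip: ennreal_mult)
  finally show ?thesis
    unfolding integral_cmod_hermite_fun_shift .
qed

end
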